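(* Let $\Pi$ and $\Gamma$ be tournaments with the same scores on a finite set $I$. (a) If a tournament $\Gamma'$ is obtained by reversing a $3$-cycle in $\Gamma$, then $|\beta(\Delta(\Gamma',\Pi)) - \beta(\Delta(\Gamma,\Pi))| = 1$. (b) If $\Pi \neq \Gamma$, then there exists a tournament $\Gamma'$ obtained by reversing a $3$-cycle in $\Gamma$ such that $\beta(\Delta(\Gamma',\Pi)) = \beta(\Delta(\Gamma,\Pi)) - 1$. (c) Assume that $C$ is a $3$-cycle contained in $\Delta(\Gamma,\Pi)$ but which is not contained in any maximum decomposition of $\Delta(\Gamma,\Pi)$. If the tournament $\Gamma'$ is obtained by reversing the $3$-cycle $C$ in $\Gamma$, then $\beta(\Delta(\Gamma',\Pi)) = \beta(\Delta(\Gamma,\Pi)) + 1$.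
   Context: A digraph on $I$ is a relation $\Pi \subset I\times I$ with $\Pi\cap\Pi^{-1}=\emptyset$; it is a tournament if for distinct $i,j$ exactly one of $(i,j),(j,i)$ is in $\Pi$. $\Pi(i)=\{j:(i,j)\in\Pi\}$. Tournaments $\Pi,\Gamma$ on $I$ have the same scores if $|\Pi(i)|=|\Gamma(i)|$ for all $i\in I$. A digraph is Eulerian if $|\Pi(i)|=|\Pi^{-1}(i)|$ for all $i$. Define $\Delta(\Gamma,\Pi) = \{(i,j)\in\Gamma : (j,i)\in\Pi\}$; it is Eulerian when $\Gamma$ and $\Pi$ have the same scores. A $k$-cycle ($k\ge3$) is a digraph $\langle i_1,\dots,i_k\rangle=\{(i_1,i_2),\dots,(i_{k-1},i_k),(i_k,i_1)\}$ with $i_1,\dots,i_k$ distinct. Reversing a cycle $C\subset\Gamma$ in $\Gamma$ means replacing $\Gamma$ by $(\Gamma\setminus C)\cup C^{-1}$. A decomposition of an Eulerian digraph $\Delta$ is a set of pairwise edge-disjoint cycles with union $\Delta$; a maximum decomposition is one of maximum cardinality, and this maximum cardinality is the span $\sigma(\Delta)$ (with $\sigma(\emptyset)=0$). The balance invariant is $\beta(\Delta)=|\Delta|-2\sigma(\Delta)$, where $|\Delta|$ is the number of edges. In (c), "contained in a maximum decomposition" means being one of the cycles of the decomposition. *)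

theory Defs
  imports Main
begin

definition digraph :: "'a set \<Rightarrow> 'a rel \<Rightarrow> bool" where
  "digraph I P \<longleftrightarrow> P \<subseteq> I \<times> I \<and> P \<inter> P\<inverse> = {}"

definition tournament :: "'a set \<Rightarrow> 'a rel \<Rightarrow> bool" where
  "tournament I P \<longleftrightarrow> digraph I P \<and>
     (\<forall>i\<in>I. \<forall>j\<in>I. i \<noteq> j \<longrightarrow> ((i, j) \<in> P) \<noteq> ((j, i) \<in> P))"

definition same_scores :: "'a set \<Rightarrow> 'a rel \<Rightarrow> 'a rel \<Rightarrow> bool" where
  "same_scores I P G \<longleftrightarrow> (\<forall>i\<in>I. card (P `` {i}) = card (G `` {i}))"

definition Delta :: "'a rel \<Rightarrow> 'a rel \<Rightarrow> 'a rel" where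
  "Delta G P = {(i, j). (i, j) \<in> G \<and> (j, i) \<in> P}"

definition cycle_of_list :: "'a list \<Rightarrow> 'a rel" where
  "cycle_of_list xs = {(xs ! i, xs ! (Suc i mod length xs)) | i. i < length xs}"

definition is_cycle :: "nat \<Rightarrow> 'a rel \<Rightarrow> bool" where
  "is_cycle k C \<longleftrightarrow> k \<ge> 3 \<and> (\<exists>xs. length xs = k \<and> distinct xs \<and> C = cycle_of_list xs)"

definition reverse_cycle :: "'a rel \<Rightarrow> 'a rel \<Rightarrow> 'a rel" where
  "reverse_cycle C G = (G - C) \<union> C\<inverse>"

text \<open>The notions below are meant for a finite Eulerian digraph \<open>D\<close>. Such a digraph always has a
  decomposition, and it has only finitely many, so the \<^const>\<open>Max\<close> in \<open>span\<close> is attained. The empty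
  digraph has the empty decomposition only, so its span is 0.\<close>

definition decomposition :: "'a rel \<Rightarrow> 'a rel set \<Rightarrow> bool" where
  "decomposition D \<C> \<longleftrightarrow> (\<forall>C\<in>\<C>. \<exists>k. is_cycle k C) \<and> pairwise disjnt \<C> \<and> \<Union>\<C> = D"

definition max_decomposition :: "'a rel \<Rightarrow> 'a rel set \<Rightarrow> bool" where
  "max_decomposition D \<C> \<longleftrightarrow> decomposition D \<C> \<and>
     (\<forall>\<C>'. decomposition D \<C>' \<longrightarrow> card \<C>' \<le> card \<C>)"

definition span :: "'a rel \<Rightarrow> nat" where
  "span D = Max {card \<C> | \<C>. decomposition D \<C>}"

definition balance :: "'a rel \<Rightarrow> int" where
  "balance D = int (card D) - 2 * int (span D)"

end

theory Submission
  imports Defs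
begin

text \<open>Write \<open>D\<close> for \<open>\<Delta>(\<Gamma>, \<Pi>)\<close> and let \<open>C\<close> be the reversed triangle, with \<open>m\<close> edges in \<open>D\<close>. Reversal
  deletes these \<open>m\<close> edges from \<open>D\<close> and inserts the opposites of the other \<open>3 - m\<close>. Take a maximum
  decomposition of \<open>D\<close> and dissolve its \<open>k \<le> m\<close> cycles that meet \<open>C\<close>; what remains of them together
  with the inserted edges is an Eulerian digraph \<open>R\<close>, so the new span is at least \<open>\<sigma>(D) - k + \<sigma>(R)\<close>.
  If \<open>k = m\<close> then \<open>R\<close> is nonempty, so the span drops by at most \<open>m - 1\<close>, which says that the
  balance grows by at most 1. Parity and the same bound for the inverse reversal give (a). For (b),
  walk along a cycle of the decomposition starting at \<open>v\<close>: some edge \<open>(p, q)\<close> of it has \<open>(v, p)\<close> and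
  \<open>(q, v)\<close> in \<open>\<Gamma>\<close>, and for this triangle the bound improves by one. For (c), if the balance
  decreased, adding \<open>C\<close> to a maximum decomposition of \<open>D - C\<close> would give one of \<open>D\<close>.\<close>

section \<open>Vertex excess and Eulerian digraphs\<close>

text \<open>Out-degree minus in-degree, summed over edges so that it is additive on edge-disjoint
  unions and telescopes along walks; \<open>excess_eq_card\<close> gives the degree form.\<close>

definition excess :: "'a rel \<Rightarrow> 'a \<Rightarrow> int" where
  "excess E v = (\<Sum>e\<in>E. of_bool (fst e = v) - of_bool (snd e = v))"

text \<open>Disjointness from the converse excludes loops and 2-cycles, so that shortest closed
  walks have length at least 3.\<close>

definition eulerian :: "'a rel \<Rightarrow> bool" where
  "eulerian E \<longleftrightarrow> finite E \<and> E \<inter> E\<inverse> = {} \<and> (\<forall>v. excess E v = 0)"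

text \<open>The effect on \<open>Delta G P\<close> of reversing \<open>C\<close> in
  \<open>G\<close>, as \<open>Delta_reverse_cycle\<close> shows.\<close>

definition flip :: "'a rel \<Rightarrow> 'a rel \<Rightarrow> 'a rel" where
  "flip C D = (D - C) \<union> (C - D)\<inverse>"

lemma excess_empty [simp]: "excess {} v = 0"
  by (simp add: excess_def)

lemma excess_singleton: "excess {(a, b)} v = of_bool (a = v) - of_bool (b = v)"
  by (simp add: excess_def)

lemma excess_Un:
  "\<lbrakk>finite A; finite B; A \<inter> B = {}\<rbrakk> \<Longrightarrow> excess (A \<union> B) v = excess A v + excess B v"
  by (simp add: excess_def sum.union_disjoint)

lemma excess_Diff:
  "\<lbrakk>finite A; B \<subseteq> A\<rbrakk> \<Longrightarrow> excess (A - B) v = excess A v - excess B v"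
  by (simp add: excess_def sum_diff)

lemma excess_converse: "excess (E\<inverse>) v = - excess E v"
proof -
  have "excess (E\<inverse>) v = (\<Sum>e\<in>prod.swap ` E. of_bool (fst e = v) - of_bool (snd e = v))"
    unfolding excess_def by (rule arg_cong[of _ _ "sum _"]) auto
  also have "\<dots> = (\<Sum>e\<in>E. of_bool (snd e = v) - of_bool (fst e = v))"
    by (subst sum.reindex) auto
  finally show ?thesis by (simp add: excess_def sum_negf[symmetric])
qed

lemma excess_eq_card:
  assumes "finite E"
  shows "excess E v = int (card (E `` {v})) - int (card (E\<inverse> `` {v}))"
proof -
  have 1: "card {e \<in> E. fst e = v} = card (E `` {v})"
    by (rule bij_betw_same_card[of snd]) (force simp: bij_betw_def inj_on_def)
  have 2: "card {e \<in> E. snd e = v} = card (E\<inverse> `` {v})"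
    by (rule bij_betw_same_card[of fst]) (force simp: bij_betw_def inj_on_def)
  show ?thesis
    using assms unfolding excess_def
    by (simp add: sum_subtractf sum_of_bool_eq 1[symmetric] 2[symmetric] Int_def)
qed

lemma excess_walk:
  assumes "inj_on (\<lambda>i. (f i, f (Suc i))) {..<n}"
  shows "excess ((\<lambda>i. (f i, f (Suc i))) ` {..<n}) v = of_bool (f 0 = v) - of_bool (f n = v)"
  using assms sum_lessThan_telescope'[of "\<lambda>i. of_bool (f i = v) :: int" n]
  by (simp add: excess_def sum.reindex)

lemma eulerian_Diff:
  assumes "eulerian E" "eulerian F" "F \<subseteq> E"
  shows "eulerian (E - F)"
  using assms by (auto simp: eulerian_def excess_Diff)

section \<open>Cycles and triangles\<close>

text \<open>Reducing both indices modulo the length presents the cycle as a closed walk of a single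
  function, the form that \<open>excess_walk\<close> needs.\<close>

lemma cycle_of_list_conv_image:
  assumes "xs \<noteq> []"
  shows "cycle_of_list xs =
    (\<lambda>i. (xs ! (i mod length xs), xs ! (Suc i mod length xs))) ` {..<length xs}"
  by (force simp: cycle_of_list_def)

lemma inj_on_cycle_edges:
  assumes "distinct xs"
  shows "inj_on (\<lambda>i. (xs ! (i mod length xs), xs ! (Suc i mod length xs))) {..<length xs}"
  using assms by (auto simp: inj_on_def nth_eq_iff_index_eq)

lemma card_cycle:
  assumes "is_cycle k C"
  shows "card C = k"
proof -
  obtain xs where xs: "length xs = k" "distinct xs" "C = cycle_of_list xs" "k \<ge> 3"
    using assms by (auto simp: is_cycle_def)
  then have "xs \<noteq> []" by auto
  then show ?thesis
    using xs card_image[OF inj_on_cycle_edges[OF xs(2)]] by (simp add: cycle_of_list_conv_image)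
qed

lemma finite_cycle: "is_cycle k C \<Longrightarrow> finite C"
  by (rule card_ge_0_finite) (auto simp: card_cycle is_cycle_def)

lemma cycle_nonempty: "is_cycle k C \<Longrightarrow> C \<noteq> {}"
  using card_cycle[of k C] by (auto simp: is_cycle_def)

lemma excess_cycle:
  assumes "is_cycle k C"
  shows "excess C v = 0"
proof -
  obtain xs where xs: "length xs = k" "distinct xs" "C = cycle_of_list xs" "k \<ge> 3"
    using assms by (auto simp: is_cycle_def)
  then have "xs \<noteq> []" by auto
  then show ?thesis
    using excess_walk[of "\<lambda>i. xs ! (i mod length xs)" "length xs" v]
      inj_on_cycle_edges[of xs] xs by (simp add: cycle_of_list_conv_image)
qed

lemma triangle_iff:
  "is_cycle 3 C \<longleftrightarrow>
    (\<exists>a b c. a \<noteq> b \<and> b \<noteq> c \<and> a \<noteq> c \<and> C = {(a, b), (b, c), (c, a)})"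
proof -
  have *: "cycle_of_list [a, b, c] = {(a, b), (b, c), (c, a)}" for a b c :: 'a
    by (auto simp: cycle_of_list_conv_image lessThan_Suc)
  show ?thesis (is "_ \<longleftrightarrow> ?R")
  proof
    assume "is_cycle 3 C"
    then obtain xs where xs: "length xs = 3" "distinct xs" "C = cycle_of_list xs"
      by (auto simp: is_cycle_def)
    then obtain a b c where "xs = [a, b, c]"
      by (auto simp: numeral_3_eq_3 length_Suc_conv)
    then have "a \<noteq> b \<and> b \<noteq> c \<and> a \<noteq> c \<and> C = {(a, b), (b, c), (c, a)}"
      using xs * by auto
    then show ?R by blast
  next
    assume ?R
    then obtain a b c where "a \<noteq> b" "b \<noteq> c" "a \<noteq> c" "C = cycle_of_list [a, b, c]"
      by (metis *)
    then show "is_cycle 3 C"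
      unfolding is_cycle_def by (intro conjI exI[of _ "[a, b, c]"]) auto
  qed
qed

lemma triangle_converse:
  assumes "is_cycle 3 C"
  shows "is_cycle 3 (C\<inverse>)"
proof -
  obtain a b c where "a \<noteq> b" "b \<noteq> c" "a \<noteq> c" "C = {(a, b), (b, c), (c, a)}"
    using assms triangle_iff by metis
  then have "c \<noteq> b \<and> b \<noteq> a \<and> c \<noteq> a \<and> C\<inverse> = {(c, b), (b, a), (a, c)}" by auto
  then show ?thesis using triangle_iff by metis
qed

text \<open>A shortest closed walk is a cycle.\<close>

lemma eulerian_contains_cycle:
  assumes E: "eulerian E" and "E \<noteq> {}"
  obtains k C where "is_cycle k C" "C \<subseteq> E"
proof -
  have fin: "finite E" and anti: "E \<inter> E\<inverse> = {}" using E by (auto simp: eulerian_def)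
  \<comment> \<open>A vertex that is entered has positive in-degree, hence positive
    out-degree.\<close>
  have succ: "\<exists>z. (y, z) \<in> E" if "(x, y) \<in> E" for x y
  proof -
    have "card (E `` {y}) = card (E\<inverse> `` {y})"
      using E excess_eq_card[OF fin, of y] by (simp add: eulerian_def)
    moreover have "card (E\<inverse> `` {y}) > 0"
      using that fin by (auto simp: card_gt_0_iff)
    ultimately have "E `` {y} \<noteq> {}" by auto
    then show ?thesis by auto
  qed
  \<comment> \<open>If \<open>E\<close> were acyclic, finiteness would make its converse
    well-founded, and a minimal vertex of \<open>Range E\<close> would have no successor, against
    \<open>succ\<close>.\<close>
  have "\<not> acyclic E"
  proof
    assume "acyclic E"
    then have "wf (E\<inverse>)" by (simp add: fin finite_acyclic_wf_converse)
    moreover have "Range E \<noteq> {}" using \<open>E \<noteq> {}\<close> by auto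
    ultimately obtain z where "z \<in> Range E" "\<And>y. (y, z) \<in> E\<inverse> \<Longrightarrow> y \<notin> Range E"
      using wfE_min' by metis
    then show False using succ by blast
  qed
  then have "\<exists>n. n > 0 \<and> (\<exists>x. (x, x) \<in> E ^^ n)"
    by (auto simp: acyclic_def trancl_power)
  then obtain n where n: "n > 0" "\<exists>x. (x, x) \<in> E ^^ n"
    and least: "\<And>m. m < n \<Longrightarrow> \<not> (m > 0 \<and> (\<exists>x. (x, x) \<in> E ^^ m))"
    using exists_least_iff[of "\<lambda>n. n > 0 \<and> (\<exists>x. (x, x) \<in> E ^^ n)"] by auto
  obtain f where f: "f n = f 0" "\<And>i. i < n \<Longrightarrow> (f i, f (Suc i)) \<in> E"
    using n(2) by (auto simp: relpow_fun_conv)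
  \<comment> \<open>A repeated vertex would cut off a closed walk of the smaller length
    \<open>j - i\<close>.\<close>
  have neq: "f i \<noteq> f j" if "i < j" "j < n" for i j
  proof
    assume "f i = f j"
    then have "(f i, f i) \<in> E ^^ (j - i)"
      unfolding relpow_fun_conv using that f(2) by (intro exI[of _ "\<lambda>k. f (i + k)"]) auto
    then show False using least[of "j - i"] that by auto
  qed
  have "n \<noteq> 1" using f anti by auto
  moreover have "n \<noteq> 2" using f(1) f(2)[of 0] f(2)[of 1] anti by (auto simp: numeral_2_eq_2)
  ultimately have "n \<ge> 3" using n(1) by linarith
  let ?xs = "map f [0..<n]"
  have "distinct ?xs"
    using neq by (auto simp: distinct_map inj_on_def) (metis nat_neq_iff)
  then have "is_cycle n (cycle_of_list ?xs)"
    using \<open>n \<ge> 3\<close> unfolding is_cycle_def by (intro conjI exI[of _ ?xs]) auto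
  moreover have "cycle_of_list ?xs \<subseteq> E"
  proof
    fix e assume "e \<in> cycle_of_list ?xs"
    then obtain i where i: "i < n" "e = (f i, ?xs ! (Suc i mod n))"
      by (auto simp: cycle_of_list_def)
    \<comment> \<open>For the closing edge the index wraps around to 0, where
      \<open>f 0 = f n\<close>.\<close>
    have "?xs ! (Suc i mod n) = f (Suc i)"
      using i f(1) n(1) by (cases "Suc i = n") auto
    then show "e \<in> E" using i f(2) by auto
  qed
  ultimately show ?thesis using that by blast
qed

section \<open>Decompositions and the span\<close>

lemma decomposition_finite: "\<lbrakk>finite D; decomposition D \<C>\<rbrakk> \<Longrightarrow> finite \<C>"
  by (simp add: decomposition_def finite_UnionD)

lemma decomposition_Un:
  assumes "decomposition D \<C>" "decomposition E \<D>" "D \<inter> E = {}" "finite D" "finite E"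
  shows "decomposition (D \<union> E) (\<C> \<union> \<D>)" "card (\<C> \<union> \<D>) = card \<C> + card \<D>"
proof -
  have disj: "disjnt A B" if "A \<in> \<C>" "B \<in> \<D>" for A B
    using that assms by (auto simp: decomposition_def disjnt_def)
  show "decomposition (D \<union> E) (\<C> \<union> \<D>)"
    unfolding decomposition_def
  proof (intro conjI)
    show "\<forall>C\<in>\<C> \<union> \<D>. \<exists>k. is_cycle k C" "\<Union> (\<C> \<union> \<D>) = D \<union> E"
      using assms by (auto simp: decomposition_def)
    show "pairwise disjnt (\<C> \<union> \<D>)"
      using assms disj by (auto simp: decomposition_def pairwise_def disjnt_sym)
  qed
  \<comment> \<open>A common member would be disjoint from itself, but cycles are nonempty.\<close>
  have "\<C> \<inter> \<D> = {}"
    using disj assms(1) cycle_nonempty by (fastforce simp: decomposition_def disjnt_def)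
  then show "card (\<C> \<union> \<D>) = card \<C> + card \<D>"
    using assms decomposition_finite by (metis card_Un_disjoint)
qed

lemma decomposition_subset:
  "\<lbrakk>decomposition D \<C>; \<D> \<subseteq> \<C>\<rbrakk> \<Longrightarrow> decomposition (\<Union>\<D>) \<D>"
  unfolding decomposition_def pairwise_def by blast

lemma decomposition_singleton: "is_cycle k C \<Longrightarrow> decomposition C {C}"
  by (auto simp: decomposition_def)

lemma decomposition_eulerian:
  assumes "decomposition D \<C>" "finite D" "D \<inter> D\<inverse> = {}"
  shows "eulerian D"
proof -
  have "excess D v = 0" for v
  proof -
    have "excess (\<Union>\<C>) v = (\<Sum>C\<in>\<C>. excess C v)"
      unfolding excess_def using assms(1)
      by (subst sum.Union_disjoint)
        (auto simp: decomposition_def pairwise_def disjnt_def intro: finite_cycle)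
    also have "\<dots> = 0"
      using assms(1) by (intro sum.neutral) (auto simp: decomposition_def intro: excess_cycle)
    finally show ?thesis using assms(1) by (simp add: decomposition_def)
  qed
  then show ?thesis using assms by (simp add: eulerian_def)
qed

text \<open>Splitting off one cycle leaves a smaller Eulerian digraph.\<close>

lemma eulerian_decomposition_exists: "eulerian D \<Longrightarrow> \<exists>\<C>. decomposition D \<C>"
proof (induction "card D" arbitrary: D rule: less_induct)
  case less
  show ?case
  proof (cases "D = {}")
    case True
    then show ?thesis by (auto simp: decomposition_def intro: exI[of _ "{}"])
  next
    case False
    then obtain k C where C: "is_cycle k C" "C \<subseteq> D"
      using less.prems eulerian_contains_cycle by blast
    have fin: "finite D" using less.prems by (simp add: eulerian_def)
    have "eulerian (D - C)"
      using C less.prems excess_cycle by (auto simp: eulerian_def excess_Diff)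
    moreover have "card (D - C) < card D"
      using C fin cycle_nonempty[OF C(1)] by (intro psubset_card_mono) auto
    ultimately obtain \<C> where "decomposition (D - C) \<C>" using less.hyps by blast
    then have "decomposition (D - C \<union> C) (\<C> \<union> {C})"
      using C fin by (intro decomposition_Un) (auto simp: decomposition_singleton finite_cycle)
    moreover have "D - C \<union> C = D" using C by auto
    ultimately show ?thesis by auto
  qed
qed

text \<open>Every decomposition is a set of subsets of \<open>D\<close>; this makes the
  \<open>Max\<close> in \<open>span\<close> meaningful.\<close>

lemma finite_decomposition_cards: "finite D \<Longrightarrow> finite {card \<C> | \<C>. decomposition D \<C>}"
  by (rule finite_subset[of _ "card ` Pow (Pow D)"]) (auto simp: decomposition_def)

lemma card_decomposition_le_span: "\<lbrakk>finite D; decomposition D \<C>\<rbrakk> \<Longrightarrow> card \<C> \<le> span D"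
  unfolding span_def by (rule Max_ge) (auto simp: finite_decomposition_cards)

lemma span_attained:
  assumes "eulerian D"
  obtains \<C> where "decomposition D \<C>" "card \<C> = span D"
proof -
  have "span D \<in> {card \<C> | \<C>. decomposition D \<C>}"
    unfolding span_def using assms eulerian_decomposition_exists finite_decomposition_cards
    by (intro Max_in) (auto simp: eulerian_def)
  then show ?thesis using that by auto
qed

lemma span_Un_ge:
  assumes "eulerian D" "eulerian E" "D \<inter> E = {}"
  shows "span D + span E \<le> span (D \<union> E)"
proof -
  have fin: "finite D" "finite E" using assms by (auto simp: eulerian_def)
  obtain \<C> \<D> where "decomposition D \<C>" "card \<C> = span D" "decomposition E \<D>" "card \<D> = span E"
    using assms span_attained by metis
  then show ?thesis
    using decomposition_Un[of D \<C> E \<D>] assms(3) fin card_decomposition_le_span[of "D \<union> E"]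
    by (metis finite_Un)
qed

lemma span_pos:
  assumes "eulerian D" "D \<noteq> {}"
  shows "span D \<ge> 1"
proof -
  obtain \<C> where "decomposition D \<C>" using assms eulerian_decomposition_exists by blast
  moreover have "finite D" using assms by (simp add: eulerian_def)
  moreover have "card \<C> > 0"
    using calculation assms decomposition_finite by (auto simp: decomposition_def card_gt_0_iff)
  ultimately show ?thesis using card_decomposition_le_span[of D \<C>] by linarith
qed

section \<open>Flipping a cycle in an Eulerian digraph\<close>

text \<open>Deleting \<open>D \<inter> C\<close> and inserting the converse of \<open>C - D\<close>
  each subtract an excess; together they subtract that of \<open>C\<close>, which is 0.\<close>

lemma eulerian_flip:
  assumes "eulerian D" "is_cycle k C" "(D \<union> C) \<inter> (D \<union> C)\<inverse> = {}"
  shows "eulerian (flip C D)"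
proof -
  have fin: "finite D" "finite C" using assms finite_cycle by (auto simp: eulerian_def)
  have "excess (flip C D) v = 0" for v
  proof -
    have "excess (flip C D) v = excess (D - D \<inter> C) v + excess ((C - D \<inter> C)\<inverse>) v"
      unfolding flip_def using fin assms(3)
      by (subst excess_Un[symmetric]) (auto intro!: arg_cong[of _ _ "\<lambda>E. excess E v"])
    also have "\<dots> = excess D v - excess C v"
      using fin by (simp add: excess_converse excess_Diff)
    also have "\<dots> = 0" using assms excess_cycle by (simp add: eulerian_def)
    finally show ?thesis .
  qed
  then show ?thesis using fin assms(3) by (auto simp: eulerian_def flip_def)
qed

lemma flip_flip:
  assumes "(D \<union> C) \<inter> (D \<union> C)\<inverse> = {}"
  shows "flip (C\<inverse>) (flip C D) = D"
  using assms by (fastforce simp: flip_def)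

lemma card_flip:
  assumes "finite D" "is_cycle 3 C" "(D \<union> C) \<inter> (D \<union> C)\<inverse> = {}"
  shows "int (card (flip C D)) = int (card D) + 3 - 2 * int (card (D \<inter> C))"
proof -
  have fin: "finite C" "card C = 3" using assms finite_cycle card_cycle by auto
  have "card (flip C D) = card (D - C) + card ((C - D)\<inverse>)"
    unfolding flip_def using assms fin by (intro card_Un_disjoint) auto
  moreover have "card ((C - D)\<inverse>) = card (C - D)" by (rule card_inverse)
  moreover have "card (D - C) + card (D \<inter> C) = card D"
    using assms(1) by (metis card_Diff_subset_Int card_mono finite_Int inf_le1 le_add_diff_inverse2)
  moreover have "card (C - D) + card (D \<inter> C) = card C"
    using fin by (metis card_Diff_subset_Int card_mono finite_Int inf_commute inf_le1 le_add_diff_inverse2)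
  ultimately show ?thesis using fin by simp
qed

section \<open>Span of a flipped digraph, from a fixed maximum decomposition\<close>

locale triangle_flip =
  fixes D C :: "'a rel" and \<C> :: "'a rel set"
  assumes eulerian: "eulerian D"
    and triangle: "is_cycle 3 C"
    and antisym: "(D \<union> C) \<inter> (D \<union> C)\<inverse> = {}"
    and decomp: "decomposition D \<C>"
    and card_decomp: "card \<C> = span D"
begin

text \<open>The cycles to be dissolved; \<open>card U\<close> is the number k of the
  overview.\<close>

definition U :: "'a rel set" where
  "U = {A \<in> \<C>. A \<inter> C \<noteq> {}}"

definition R :: "'a rel" where
  "R = (\<Union>U - C) \<union> (C - D)\<inverse>"

lemma fin: "finite D" "finite C" "finite \<C>" "finite U"
proof -
  show D: "finite D" using eulerian by (simp add: eulerian_def)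
  show "finite C" using triangle by (rule finite_cycle)
  show "finite \<C>" using D decomp by (rule decomposition_finite)
  then show "finite U" by (simp add: U_def)
qed

lemma Union_decomp: "\<Union>\<C> = D"
  using decomp by (simp add: decomposition_def)

lemma disjoint: "\<lbrakk>A \<in> \<C>; B \<in> \<C>; A \<noteq> B\<rbrakk> \<Longrightarrow> A \<inter> B = {}"
  using decomp by (auto simp: decomposition_def pairwise_def disjnt_def)

text \<open>The untouched cycles survive the flip. They avoid \<open>R\<close> because the members
  of \<C> are disjoint and the inserted edges are opposite to edges of \<open>C\<close>, hence
  outside \<open>D\<close>.\<close>

lemma flip_split: "flip C D = \<Union>(\<C> - U) \<union> R" "\<Union>(\<C> - U) \<inter> R = {}"
proof -
  have "D - C = \<Union>(\<C> - U) \<union> (\<Union>U - C)"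
    unfolding Union_decomp[symmetric] U_def by auto
  then show "flip C D = \<Union>(\<C> - U) \<union> R"
    by (auto simp: flip_def R_def)
  have "\<Union>(\<C> - U) \<inter> \<Union>U = {}" using disjoint by (fastforce simp: U_def)
  moreover have "\<Union>(\<C> - U) \<subseteq> D" using Union_decomp by auto
  moreover have "D \<inter> C\<inverse> = {}" using antisym by auto
  ultimately show "\<Union>(\<C> - U) \<inter> R = {}" unfolding R_def by blast
qed

lemma eulerian_rest: "eulerian (\<Union>(\<C> - U))"
proof (rule decomposition_eulerian)
  show "decomposition (\<Union>(\<C> - U)) (\<C> - U)" using decomp decomposition_subset by blast
  have "\<Union>(\<C> - U) \<subseteq> D" using Union_decomp by auto
  then show "finite (\<Union>(\<C> - U))" "\<Union>(\<C> - U) \<inter> (\<Union>(\<C> - U))\<inverse> = {}"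
    using fin finite_subset antisym by blast+
qed

lemma eulerian_R: "eulerian R"
proof -
  have "R = flip C D - \<Union>(\<C> - U)" using flip_split by auto
  then show ?thesis
    using eulerian_Diff eulerian_flip eulerian_rest eulerian triangle antisym flip_split
    by (metis Un_upper1)
qed

lemma span_flip_ge: "span D + span R \<le> span (flip C D) + card U"
proof -
  have "card (\<C> - U) \<le> span (\<Union>(\<C> - U))"
    using decomp eulerian_rest
    by (intro card_decomposition_le_span decomposition_subset[of D \<C>]) (auto simp: eulerian_def)
  moreover have "span (\<Union>(\<C> - U)) + span R \<le> span (flip C D)"
    using span_Un_ge[OF eulerian_rest eulerian_R] flip_split by simp
  moreover have "card (\<C> - U) + card U = card \<C>"
    using fin card_Diff_subset[of U \<C>] card_mono[of \<C> U] by (auto simp: U_def)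
  ultimately show ?thesis using card_decomp by linarith
qed

text \<open>Sending an edge of \<open>D \<inter> C\<close> to the cycle containing it maps onto
  \<open>U\<close>. Equal cardinalities make this map injective, so no cycle then contains two edges
  of \<open>C\<close>.\<close>

lemma card_U_le: "card U \<le> card (D \<inter> C)"
  and card_U_eq: "\<lbrakk>card U = card (D \<inter> C); A \<in> \<C>; e \<in> A \<inter> C; e' \<in> A \<inter> C\<rbrakk> \<Longrightarrow> e = e'"
proof -
  have "\<forall>e\<in>D. \<exists>A\<in>\<C>. e \<in> A" using Union_decomp by auto
  then obtain f where f: "\<And>e. e \<in> D \<Longrightarrow> f e \<in> \<C> \<and> e \<in> f e" by metis
  have f_eq: "f e = A" if "A \<in> \<C>" "e \<in> A" for e A
    using that f[of e] disjoint[of A "f e"] Union_decomp by auto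
  have im: "f ` (D \<inter> C) = U"
  proof (rule set_eqI)
    fix A show "A \<in> f ` (D \<inter> C) \<longleftrightarrow> A \<in> U"
      using f f_eq Union_decomp by (fastforce simp: U_def image_iff)
  qed
  show "card U \<le> card (D \<inter> C)"
    using card_image_le[of "D \<inter> C" f] fin im by simp
  show "e = e'" if "card U = card (D \<inter> C)" "A \<in> \<C>" "e \<in> A \<inter> C" "e' \<in> A \<inter> C"
  proof -
    have "inj_on f (D \<inter> C)"
      using that(1) fin im by (intro eq_card_imp_inj_on) auto
    moreover have "e \<in> D" "e' \<in> D" using that Union_decomp by auto
    moreover have "f e = f e'" using f_eq that by auto
    ultimately show ?thesis using that by (auto dest: inj_onD)
  qed
qed

text \<open>When nothing remains of the dissolved cycles, they lie inside \<open>C\<close>, and each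
  has at least 3 edges.\<close>

lemma card_U_if_R_empty:
  assumes "R = {}"
  shows "3 * card U \<le> card (D \<inter> C)"
proof -
  have cyc: "\<exists>k. is_cycle k A" if "A \<in> U" for A
    using that decomp by (auto simp: decomposition_def U_def)
  have ge: "3 \<le> card A" if "A \<in> U" for A
    using cyc[OF that] card_cycle unfolding is_cycle_def by metis
  have "pairwise disjnt U"
    using decomp by (auto simp: decomposition_def U_def pairwise_def)
  then have "card (\<Union>U) = (\<Sum>A\<in>U. card A)"
    using cyc finite_cycle by (intro card_Union_disjoint) auto
  then have "3 * card U \<le> card (\<Union>U)"
    using sum_mono[of U "\<lambda>_. 3" card] ge by simp
  moreover have "\<Union>U \<subseteq> D \<inter> C"
    using assms Union_decomp by (auto simp: R_def U_def)
  ultimately show ?thesis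
    using card_mono[of "D \<inter> C" "\<Union>U"] fin by simp
qed

lemma span_flip_lower: "span D + 1 \<le> span (flip C D) + card (D \<inter> C)"
proof (cases "card U = card (D \<inter> C)")
  case True
  \<comment> \<open>Were \<open>R\<close> empty, the equality of cardinalities would force both
    \<open>D \<inter> C\<close> and \<open>C - D\<close> to be empty, hence \<open>C\<close>
    too.\<close>
  have "R \<noteq> {}"
  proof
    assume "R = {}"
    have "D \<inter> C = {}" using \<open>R = {}\<close> card_U_if_R_empty True fin by simp
    moreover have "C - D = {}" using \<open>R = {}\<close> by (auto simp: R_def)
    ultimately show False using cycle_nonempty[OF triangle] by auto
  qed
  then show ?thesis using span_pos[OF eulerian_R] span_flip_ge True by linarith
next
  case False
  then show ?thesis using span_flip_ge card_U_le by linarith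
qed

end

section \<open>Change of the balance under a triangle flip\<close>

text \<open>With m = \<open>card (D \<inter> C)\<close>, the edge count changes by 3 - 2m and the
  span drops by at most m - 1, so the balance grows by at most (3 - 2m) + 2(m - 1) = 1.\<close>

lemma balance_flip_le:
  assumes "eulerian D" "is_cycle 3 C" "(D \<union> C) \<inter> (D \<union> C)\<inverse> = {}"
  shows "balance (flip C D) \<le> balance D + 1"
proof -
  obtain \<C> where "decomposition D \<C>" "card \<C> = span D" using assms span_attained by metis
  then interpret triangle_flip D C \<C> using assms by unfold_locales auto
  show ?thesis
    using span_flip_lower card_flip[of D C] assms fin unfolding balance_def by simp
qed

lemma abs_balance_flip:
  assumes "eulerian D" "is_cycle 3 C" "(D \<union> C) \<inter> (D \<union> C)\<inverse> = {}"
  shows "\<bar>balance (flip C D) - balance D\<bar> = 1"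
proof -
  \<comment> \<open>Flipping the triangle \<open>C\<inverse>\<close> undoes the flip, so the upper
    bound applies in the other direction.\<close>
  have "balance D \<le> balance (flip C D) + 1"
  proof -
    have "(flip C D \<union> C\<inverse>) \<inter> (flip C D \<union> C\<inverse>)\<inverse> = {}"
      using assms(3) by (auto simp: flip_def)
    then show ?thesis
      using balance_flip_le[OF eulerian_flip[OF assms] triangle_converse[OF assms(2)]]
      by (simp add: flip_flip[OF assms(3)])
  qed
  \<comment> \<open>The edge count changes by the odd number 3 - 2m, twice the span by an even
    number.\<close>
  moreover have "odd (balance (flip C D) - balance D)"
    using card_flip[of D C] assms unfolding balance_def by (simp add: eulerian_def)
  ultimately show ?thesis using balance_flip_le[OF assms] by presburger
qed

lemma balance_flip_not_in_max_decomposition: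
  assumes "eulerian D" "is_cycle 3 C" "C \<subseteq> D"
    and "\<nexists>\<C>. max_decomposition D \<C> \<and> C \<in> \<C>"
  shows "balance (flip C D) = balance D + 1"
proof (rule ccontr)
  assume neq: "balance (flip C D) \<noteq> balance D + 1"
  have anti: "(D \<union> C) \<inter> (D \<union> C)\<inverse> = {}" and fin: "finite D"
    using assms by (auto simp: eulerian_def)
  have eq: "balance (flip C D) = balance D - 1"
    using neq abs_balance_flip[OF assms(1,2) anti] by linarith
  have DC: "flip C D = D - C" "D \<inter> C = C" using assms by (auto simp: flip_def)
  \<comment> \<open>Three edges disappear while the balance drops by 1, so the span drops by exactly
    1.\<close>
  have span: "span (D - C) + 1 = span D"
    using eq card_flip[OF fin assms(2) anti] card_cycle[OF assms(2)] DC
    unfolding balance_def by simp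
  have "eulerian (D - C)" using eulerian_flip[OF assms(1,2) anti] DC by simp
  then obtain \<C> where \<C>: "decomposition (D - C) \<C>" "card \<C> = span (D - C)"
    using span_attained by blast
  have "D - C \<union> C = D" using assms by auto
  then have "decomposition D (\<C> \<union> {C})" "card (\<C> \<union> {C}) = span D"
    using decomposition_Un[OF \<C>(1) decomposition_singleton[OF assms(2)]] fin
      finite_cycle[OF assms(2)] \<C>(2) span by auto
  then have "max_decomposition D (\<C> \<union> {C})"
    using card_decomposition_le_span fin by (auto simp: max_decomposition_def)
  then show False using assms(4) by blast
qed

text \<open>If each dissolved cycle loses exactly one edge, the two arcs of \<open>A\<close> cut off by \<open>v\<close> and the edge
  \<open>(p, q)\<close> lie in two edge-disjoint Eulerian parts of \<open>R\<close>, so \<open>R\<close> has span at least 2.\<close>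

lemma (in triangle_flip) span_flip_lower_chord:
  assumes xs: "distinct xs" "length xs \<ge> 3" "cycle_of_list xs \<in> \<C>"
    and j: "0 < j" "Suc j < length xs"
    and v: "v = xs ! 0" "p = xs ! j" "q = xs ! Suc j"
    and C_eq: "C = {(v, p), (p, q), (q, v)}"
  shows "span D + 2 \<le> span (flip C D) + card (D \<inter> C)"
proof -
  have C: "e \<in> C \<longleftrightarrow> e = (v, p) \<or> e = (p, q) \<or> e = (q, v)" for e
    using C_eq by auto
  have ne: "xs \<noteq> []" using xs by auto
  define A where "A = cycle_of_list xs"
  have AC: "A \<in> \<C>" and AD: "A \<subseteq> D" using xs Union_decomp by (auto simp: A_def)
  have pq: "(p, q) \<in> A"
    unfolding A_def cycle_of_list_def v using j by (auto intro!: exI[of _ j])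
  have AU: "A \<in> U" using AC pq C by (auto simp: U_def)
  have vpq: "v \<noteq> p" "v \<noteq> q" "p \<noteq> q" using xs j ne by (auto simp: v nth_eq_iff_index_eq)
  have "card U > 0" using AU fin by (auto simp: card_gt_0_iff)
  \<comment> \<open>By \<open>span_flip_ge\<close>, it suffices that \<open>R\<close> has span at
    least 2, 1 or 0 in these cases, respectively.\<close>
  consider "card U = card (D \<inter> C)" | "Suc (card U) = card (D \<inter> C)" | "Suc (Suc (card U)) \<le> card (D \<inter> C)"
    using card_U_le by linarith
  then show ?thesis
  proof cases
    case 1
    note uniq = card_U_eq[OF 1]
    \<comment> \<open>\<open>P\<close> is the arc of \<open>A\<close> from \<open>v\<close> to
      \<open>p\<close>; \<open>l\<close> is the last edge of \<open>A\<close>, which returns to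
      \<open>v\<close> on the complementary arc.\<close>
    define P where "P = (\<lambda>i. (xs ! i, xs ! Suc i)) ` {..<j}"
    define l where "l = (xs ! (length xs - 1), v)"
    have PA: "P \<subseteq> A"
      unfolding A_def P_def cycle_of_list_def using j by (auto intro!: exI)
    have finP: "finite P" by (simp add: P_def)
    have lA: "l \<in> A"
      unfolding A_def l_def cycle_of_list_def v using ne
      by (auto simp: Suc_diff_Suc intro!: exI[of _ "length xs - 1"])
    have "inj_on (\<lambda>i. (xs ! i, xs ! Suc i)) {..<j}"
      using xs j ne by (auto simp: inj_on_def nth_eq_iff_index_eq)
    then have excP: "excess P u = of_bool (v = u) - of_bool (p = u)" for u
      unfolding P_def using excess_walk[of "\<lambda>i. xs ! i" j u] by (simp add: v)
    have "(p, q) \<notin> P" using xs j ne by (auto simp: P_def v nth_eq_iff_index_eq)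
    moreover have only: "e = (p, q)" if "e \<in> A \<inter> C" for e
      using uniq[OF AC that, of "(p, q)"] pq C by auto
    ultimately have PC: "P \<inter> C = {}" using PA by blast
    have lP: "l \<notin> P" using xs j ne by (auto simp: l_def P_def v nth_eq_iff_index_eq)
    have lC: "l \<notin> C" using only[of l] lA vpq by (auto simp: l_def)
    \<comment> \<open>\<open>Z\<close> balances \<open>P\<close> by leading from \<open>p\<close>
      back to \<open>v\<close>: it is the rest of the cycle through \<open>(v, p)\<close> if that
      edge is in \<open>D\<close>, and otherwise the inserted edge \<open>(p, v)\<close>.\<close>
    obtain Z where Z: "Z \<subseteq> R" "A \<inter> Z = {}" "\<And>u. excess Z u = of_bool (p = u) - of_bool (v = u)"
    proof (cases "(v, p) \<in> D")
      case True
      then obtain B where B: "B \<in> \<C>" "(v, p) \<in> B" using Union_decomp by auto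
      obtain k where k: "is_cycle k B" using B decomp by (auto simp: decomposition_def)
      have "B \<inter> C \<subseteq> {(v, p)}" using uniq[OF B(1), of "(v, p)"] B(2) C by blast
      moreover have "B \<in> U" using B C by (auto simp: U_def)
      ultimately have "B - {(v, p)} \<subseteq> R" by (auto simp: R_def)
      moreover have "A \<noteq> B" using uniq[OF B(1), of "(v, p)" "(p, q)"] B pq C vpq by auto
      then have "A \<inter> (B - {(v, p)}) = {}" using disjoint[OF AC B(1)] by auto
      moreover have "excess (B - {(v, p)}) u = of_bool (p = u) - of_bool (v = u)" for u
        using B(2) finite_cycle[OF k] excess_cycle[OF k]
        by (simp add: excess_Diff excess_singleton)
      ultimately show ?thesis using that by blast
    next
      case False
      then have "{(p, v)} \<subseteq> R" using C by (auto simp: R_def)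
      moreover have "A \<inter> {(p, v)} = {}" using AD antisym C by auto
      ultimately show ?thesis using that[of "{(p, v)}"] by (simp add: excess_singleton)
    qed
    have "P \<subseteq> R" using PA PC AU by (auto simp: R_def)
    then have sub: "P \<union> Z \<subseteq> R" using Z by auto
    have finR: "finite R" "R \<inter> R\<inverse> = {}" using eulerian_R by (auto simp: eulerian_def)
    have "finite Z" using Z finR finite_subset by blast
    then have "excess (P \<union> Z) u = 0" for u
      using excess_Un[of P Z u] finP Z PA excP by (auto simp: of_bool_def)
    then have eul: "eulerian (P \<union> Z)"
      using finP \<open>finite Z\<close> finR sub by (auto simp: eulerian_def)
    then have eul': "eulerian (R - (P \<union> Z))" using eulerian_R sub eulerian_Diff by blast
    \<comment> \<open>The edge \<open>l\<close> shows that the second Eulerian part, the complement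
      of \<open>P \<union> Z\<close> in \<open>R\<close>, is nonempty.\<close>
    have "l \<in> R - (P \<union> Z)" using lA lP lC AU Z by (auto simp: R_def)
    then have "span (R - (P \<union> Z)) \<ge> 1" using span_pos[OF eul'] by auto
    moreover have "P \<noteq> {}" using j by (auto simp: P_def)
    then have "span (P \<union> Z) \<ge> 1" using span_pos[OF eul] by auto
    moreover have "span (P \<union> Z) + span (R - (P \<union> Z)) \<le> span R"
      using span_Un_ge[OF eul eul'] sub by (simp add: Un_absorb1)
    ultimately show ?thesis using span_flip_ge 1 by linarith
  next
    case 2
    \<comment> \<open>Otherwise \<open>3 * card U \<le> card U + 1\<close>, which is impossible for
      positive \<open>card U\<close>.\<close>
    have "R \<noteq> {}"
      using card_U_if_R_empty 2 \<open>card U > 0\<close> by fastforce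
    then show ?thesis using span_pos[OF eulerian_R] span_flip_ge 2 by linarith
  next
    case 3
    then show ?thesis using span_flip_ge by linarith
  qed
qed

section \<open>Tournaments and their difference digraph\<close>

lemma tournamentD:
  assumes "tournament I G"
  shows "G \<subseteq> I \<times> I"
    and "(i, j) \<in> G \<Longrightarrow> (j, i) \<notin> G"
    and "\<lbrakk>i \<in> I; j \<in> I; i \<noteq> j; (i, j) \<notin> G\<rbrakk> \<Longrightarrow> (j, i) \<in> G"
  using assms unfolding tournament_def digraph_def by blast+

text \<open>An edge of \<open>C\<close> either disagrees with \<open>P\<close> and leaves the
  difference when reversed, or lies in \<open>P\<close>, and then its reverse enters.\<close>

lemma Delta_reverse_cycle:
  assumes "tournament I P" "tournament I G" "C \<subseteq> G"
  shows "Delta (reverse_cycle C G) P = flip C (Delta G P)"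
proof (rule set_eqI)
  fix e :: "'a \<times> 'a"
  obtain i j where e: "e = (i, j)" by (cases e)
  have 1: "i \<in> I \<and> j \<in> I \<and> i \<noteq> j" if "(j, i) \<in> G"
    using that assms(2) by (auto simp: tournament_def digraph_def)
  then have "(j, i) \<in> G \<Longrightarrow> ((i, j) \<in> P) \<noteq> ((j, i) \<in> P)"
    using assms(1) by (auto simp: tournament_def)
  then show "e \<in> Delta (reverse_cycle C G) P \<longleftrightarrow> e \<in> flip C (Delta G P)"
    using assms(3) by (auto simp: e Delta_def reverse_cycle_def flip_def)
qed

lemma tournament_reverse_cycle:
  assumes "tournament I G" "C \<subseteq> G"
  shows "tournament I (reverse_cycle C G)"
proof -
  note G = tournamentD[OF assms(1)]
  have "C \<subseteq> I \<times> I" using G(1) assms(2) by auto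
  then have "reverse_cycle C G \<subseteq> I \<times> I" using G(1) by (auto simp: reverse_cycle_def)
  moreover have "(j, i) \<notin> reverse_cycle C G" if "(i, j) \<in> reverse_cycle C G" for i j
    using that G(2)[of i j] G(2)[of j i] assms(2) by (auto simp: reverse_cycle_def)
  ultimately have "digraph I (reverse_cycle C G)" by (auto simp: digraph_def)
  moreover have "((i, j) \<in> reverse_cycle C G) \<noteq> ((j, i) \<in> reverse_cycle C G)"
    if "i \<in> I" "j \<in> I" "i \<noteq> j" for i j
  proof -
    have *: "(x, y) \<in> reverse_cycle C G \<longleftrightarrow> (x, y) \<in> G \<and> (x, y) \<notin> C \<or> (y, x) \<in> C" for x y
      by (auto simp: reverse_cycle_def)
    show ?thesis
      unfolding * using G(2)[of i j] G(3)[OF that] assms(2) by blast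
  qed
  ultimately show ?thesis unfolding tournament_def by blast
qed

lemma Delta_conv_Diff:
  assumes "tournament I P" "tournament I G"
  shows "Delta G P = G - P" "(Delta G P)\<inverse> = P - G"
proof -
  have iff: "(i, j) \<in> P \<longleftrightarrow> (j, i) \<notin> P" "(i, j) \<in> G \<longleftrightarrow> (j, i) \<notin> G"
    if "i \<in> I" "j \<in> I" "i \<noteq> j" for i j
    using that tournamentD(2,3)[OF assms(1)] tournamentD(2,3)[OF assms(2)] by metis+
  have "i \<in> I \<and> j \<in> I \<and> i \<noteq> j" if "(i, j) \<in> P \<or> (i, j) \<in> G" for i j
    using that tournamentD(1,2)[OF assms(1)] tournamentD(1,2)[OF assms(2)] by blast
  then have "(i, j) \<in> G \<and> (j, i) \<in> P \<longleftrightarrow> (i, j) \<in> G \<and> (i, j) \<notin> P"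
    "(j, i) \<in> G \<and> (i, j) \<in> P \<longleftrightarrow> (i, j) \<in> P \<and> (i, j) \<notin> G" for i j
    using iff by metis+
  then show "Delta G P = G - P" "(Delta G P)\<inverse> = P - G"
    by (auto simp: Delta_def)
qed

lemma eulerian_Delta:
  assumes "finite I" "tournament I P" "tournament I G" "same_scores I P G"
  shows "eulerian (Delta G P)"
proof -
  note Delta = Delta_conv_Diff[OF assms(2,3)]
  have sub: "P \<subseteq> I \<times> I" "G \<subseteq> I \<times> I"
    using tournamentD(1) assms(2,3) by metis+
  then have fin: "finite P" "finite G" using assms(1) finite_subset by blast+
  have "card ((G - P) `` {v}) = card ((P - G) `` {v})" for v
  proof -
    have "card (P `` {v}) = card (G `` {v})"
    proof (cases "v \<in> I")
      case False
      then have "P `` {v} = {}" "G `` {v} = {}" using sub by auto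
      then show ?thesis by simp
    qed (use assms(4) in \<open>simp add: same_scores_def\<close>)
    \<comment> \<open>Out- and in-neighbours in the difference arise by removing the common
      out-neighbours from two sets of equal size.\<close>
    moreover have "(G - P) `` {v} = G `` {v} - P `` {v} \<inter> G `` {v}"
      "(P - G) `` {v} = P `` {v} - P `` {v} \<inter> G `` {v}" by auto
    ultimately show ?thesis using fin by (simp add: card_Diff_subset)
  qed
  then have "excess (Delta G P) v = 0" for v
    using fin Delta by (simp add: excess_eq_card)
  moreover have "Delta G P \<inter> (Delta G P)\<inverse> = {}"
    unfolding Delta(2) using Delta(1) by auto
  ultimately show ?thesis using fin Delta(1) by (simp add: eulerian_def)
qed

lemma Delta_eq_empty_iff:
  assumes "tournament I P" "tournament I G"
  shows "Delta G P = {} \<longleftrightarrow> P = G"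
  using Delta_conv_Diff[OF assms] by auto

section \<open>A triangle whose reversal lowers the balance\<close>

lemma balance_decreasing_triangle:
  assumes "tournament I G" "eulerian D" "D \<subseteq> G" "D \<noteq> {}"
  obtains C where "is_cycle 3 C" "C \<subseteq> G" "balance (flip C D) = balance D - 1"
proof -
  have G: "G \<subseteq> I \<times> I" "G \<inter> G\<inverse> = {}"
    "\<And>i j. \<lbrakk>i \<in> I; j \<in> I; i \<noteq> j; (i, j) \<notin> G\<rbrakk> \<Longrightarrow> (j, i) \<in> G"
    using tournamentD[OF assms(1)] by blast+
  obtain \<C> where \<C>: "decomposition D \<C>" "card \<C> = span D" using assms span_attained by metis
  then obtain A k where A: "A \<in> \<C>" "is_cycle k A"
    using assms(4) unfolding decomposition_def by blast
  then obtain xs where xs: "distinct xs" "length xs \<ge> 3" "A = cycle_of_list xs"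
    by (auto simp: is_cycle_def)
  then have "xs \<noteq> []" by auto
  have edge: "(xs ! i, xs ! (Suc i mod length xs)) \<in> G" if "i < length xs" for i
    using that A \<C>(1) xs(3) assms(3) by (auto simp: decomposition_def cycle_of_list_def)
  have edge': "(xs ! i, xs ! Suc i) \<in> G" if "Suc i < length xs" for i
    using edge[of i] that by simp
  have "xs ! i \<in> I" if "i < length xs" for i
    using edge[OF that] G(1) by auto
  then have tot: "(xs ! 0, xs ! i) \<in> G \<or> (xs ! i, xs ! 0) \<in> G" if "0 < i" "i < length xs" for i
    using that G(3)[of "xs ! 0" "xs ! i"] xs
    by (metis gr_implies_not_zero nat_neq_iff nth_eq_iff_index_eq order_less_trans)
  \<comment> \<open>The least index \<open>n\<close> whose vertex has an edge to
    \<open>xs ! 0\<close> is taken. The last vertex of the cycle qualifies and the vertex at index 1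
    does not, so the predecessor at \<open>n - 1\<close> is not the start and, by minimality,
    receives an edge from it.\<close>
  let ?Q = "\<lambda>i. 0 < i \<and> i < length xs \<and> (xs ! i, xs ! 0) \<in> G"
  have "?Q (length xs - 1)" using edge[of "length xs - 1"] \<open>xs \<noteq> []\<close> xs(2) by (auto simp: Suc_diff_Suc)
  then obtain n where n: "?Q n" "\<And>m. m < n \<Longrightarrow> \<not> ?Q m"
    using exists_least_iff[of ?Q] by blast
  have "n \<noteq> 1"
    using n(1) edge'[of 0] xs(2) G(2) by auto
  then obtain j where j: "n = Suc j" "0 < j" using n(1) by (cases n) auto
  define v p q where "v = xs ! 0" and "p = xs ! j" and "q = xs ! Suc j"
  define C where "C = {(v, p), (p, q), (q, v)}"
  have "(v, p) \<in> G" using tot[of j] n j by (auto simp: v_def p_def)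
  moreover have "(p, q) \<in> G" using edge'[of j] n j by (auto simp: p_def q_def)
  moreover have "(q, v) \<in> G" using n j by (auto simp: v_def q_def)
  ultimately have CG: "C \<subseteq> G" by (simp add: C_def)
  have "v \<noteq> p" "p \<noteq> q" "v \<noteq> q"
    using xs n j \<open>xs \<noteq> []\<close> by (auto simp: v_def p_def q_def nth_eq_iff_index_eq)
  then have C3: "is_cycle 3 C" unfolding triangle_iff C_def by blast
  have anti: "(D \<union> C) \<inter> (D \<union> C)\<inverse> = {}" using G(2) assms(3) CG by blast
  interpret triangle_flip D C \<C> using assms C3 anti \<C> by unfold_locales auto
  have "span D + 2 \<le> span (flip C D) + card (D \<inter> C)"
    using span_flip_lower_chord[OF xs(1,2) _ j(2) _ v_def p_def q_def C_def] A n j xs(3) by auto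
  \<comment> \<open>The span now drops by at most m - 2, and (3 - 2m) + 2(m - 2) = -1.\<close>
  then have "balance (flip C D) \<le> balance D - 1"
    using card_flip[OF fin(1) C3 anti] unfolding balance_def by linarith
  then have "balance (flip C D) = balance D - 1"
    using abs_balance_flip[OF assms(2) C3 anti] by linarith
  then show ?thesis using that C3 CG by blast
qed

section \<open>The three claims for tournaments with the same scores\<close>

theorem theorem4p7:
  fixes I :: "'a set" and \<Pi> \<Gamma> :: "'a rel"
  assumes "finite I"
    and "tournament I \<Pi>" and "tournament I \<Gamma>"
    and "same_scores I \<Pi> \<Gamma>"
  shows
    "(\<forall>\<Gamma>' C. is_cycle 3 C \<and> C \<subseteq> \<Gamma> \<and> \<Gamma>' = reverse_cycle C \<Gamma> \<and> tournament I \<Gamma>' \<longrightarrow>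
        \<bar>balance (Delta \<Gamma>' \<Pi>) - balance (Delta \<Gamma> \<Pi>)\<bar> = 1) \<and>
     (\<Pi> \<noteq> \<Gamma> \<longrightarrow>
        (\<exists>\<Gamma>' C. is_cycle 3 C \<and> C \<subseteq> \<Gamma> \<and> \<Gamma>' = reverse_cycle C \<Gamma> \<and> tournament I \<Gamma>' \<and>
           balance (Delta \<Gamma>' \<Pi>) = balance (Delta \<Gamma> \<Pi>) - 1)) \<and>
     (\<forall>\<Gamma>' C. is_cycle 3 C \<and> C \<subseteq> Delta \<Gamma> \<Pi> \<and>
        (\<nexists>\<C>. max_decomposition (Delta \<Gamma> \<Pi>) \<C> \<and> C \<in> \<C>) \<and>
        \<Gamma>' = reverse_cycle C \<Gamma> \<and> tournament I \<Gamma>' \<longrightarrow>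
          balance (Delta \<Gamma>' \<Pi>) = balance (Delta \<Gamma> \<Pi>) + 1)"
proof (intro conjI allI impI; (elim conjE)?)
  have eul: "eulerian (Delta \<Gamma> \<Pi>)" using eulerian_Delta assms by blast
  have sub: "Delta \<Gamma> \<Pi> \<subseteq> \<Gamma>" by (auto simp: Delta_def)
  note Delta_flip = Delta_reverse_cycle[OF assms(2,3)]
  show "\<bar>balance (Delta \<Gamma>' \<Pi>) - balance (Delta \<Gamma> \<Pi>)\<bar> = 1"
    if "is_cycle 3 C" "C \<subseteq> \<Gamma>" "\<Gamma>' = reverse_cycle C \<Gamma>" for \<Gamma>' C
  proof -
    have "\<Gamma> \<inter> \<Gamma>\<inverse> = {}" using assms(3) by (simp add: tournament_def digraph_def)
    then have "(Delta \<Gamma> \<Pi> \<union> C) \<inter> (Delta \<Gamma> \<Pi> \<union> C)\<inverse> = {}" using sub that(2) by blast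
    then show ?thesis using abs_balance_flip[OF eul that(1)] Delta_flip that by simp
  qed
  show "\<exists>\<Gamma>' C. is_cycle 3 C \<and> C \<subseteq> \<Gamma> \<and> \<Gamma>' = reverse_cycle C \<Gamma> \<and> tournament I \<Gamma>' \<and>
      balance (Delta \<Gamma>' \<Pi>) = balance (Delta \<Gamma> \<Pi>) - 1" if "\<Pi> \<noteq> \<Gamma>"
  proof -
    have "Delta \<Gamma> \<Pi> \<noteq> {}" using Delta_eq_empty_iff assms(2,3) that by metis
    then obtain C where "is_cycle 3 C" "C \<subseteq> \<Gamma>"
      "balance (flip C (Delta \<Gamma> \<Pi>)) = balance (Delta \<Gamma> \<Pi>) - 1"
      using balance_decreasing_triangle[OF assms(3) eul sub] by blast
    then show ?thesis using Delta_flip tournament_reverse_cycle[OF assms(3)] by metis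
  qed
  show "balance (Delta \<Gamma>' \<Pi>) = balance (Delta \<Gamma> \<Pi>) + 1"
    if "is_cycle 3 C" "C \<subseteq> Delta \<Gamma> \<Pi>"
      "\<nexists>\<C>. max_decomposition (Delta \<Gamma> \<Pi>) \<C> \<and> C \<in> \<C>" "\<Gamma>' = reverse_cycle C \<Gamma>" for \<Gamma>' C
    using balance_flip_not_in_max_decomposition[OF eul that(1,2,3)] Delta_flip[of C] sub that by auto
qed

end
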